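(* Consider a locally trivial bundle $p:E\to B$ with path-connected fibre $X$ and structure group $G$. Let $\tau:P\to B$ be a principal $G$-bundle such that $p:E\to B$ coincides with the associated bundle $p: E=X\times_G P=(X\times P)/G\to P/G=B$. Then for every integer $r\ge2$, $$\mathsf{TC}_r[p:E\to B]\ \le\ \mathsf{TC}_{r,G}(X).$$
   Context: $I=[0,1]$; path spaces carry the compact-open topology. $G$ is a topological group (not assumed compact) acting on $X$; $(X\times P)/G$ is the orbit space of the diagonal action. For a (Hurewicz) fibration $q:E'\to B'$, $\mathsf{secat}[q]$ is the smallest integer $k\ge0$ such that $B'$ has an open cover $U_0,\dots,U_k$ with a continuous section of $q$ over each $U_i$ ($\infty$ if none exists). Sequential parametrized topological complexity: let $E^r_B=\{(e_1,\dots,e_r)\in E^r: p(e_1)=\dots=p(e_r)\}$, let $E^I_B\subset E^I$ be the space of paths $\gamma:I\to E$ with $p\circ\gamma$ constant, fix $0\le t_1<\dots<t_r\le 1$, and let $\Pi_r:E^I_B\to E^r_B$, $\Pi_r(\gamma)=(\gamma(t_1),\dots,\gamma(t_r))$. Then $\mathsf{TC}_r[p:E\to B]=\mathsf{secat}(\Pi_r)$. Sequential equivariant topological complexity: fix $0=t_1<\dots<t_r=1$ and let $\rho_r:X^I\to X^r$, $\rho_r(\gamma)=(\gamma(t_1),\dots,\gamma(t_r))$; it is $G$-equivariant, where $(g\gamma)(t)=g\gamma(t)$ and $G$ acts diagonally on $X^r$. For a path-connected $G$-space $X$, $\mathsf{TC}_{r,G}(X)$ is the smallest integer $k\ge0$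 such that $X^r$ admits an open cover $X^r=U_0\cup\dots\cup U_k$ by $G$-invariant sets, each admitting a continuous $G$-equivariant section $s_i:U_i\to X^I$ of $\rho_r$; if no such cover exists, $\mathsf{TC}_{r,G}(X)=\infty$. *)

theory Defs
  imports "HOL-Analysis.Analysis" "HOL-Algebra.Group_Action" "HOL-Library.Extended_Nat"
begin

subsection \<open>Topological groups, continuous actions, orbit spaces\<close>

definition topological_group :: "('g, 'm) monoid_scheme \<Rightarrow> 'g topology \<Rightarrow> bool" where
  "topological_group G T \<longleftrightarrow>
     group G \<and> topspace T = carrier G \<and>
     continuous_map (prod_topology T T) T (\<lambda>(g, h). g \<otimes>\<^bsub>G\<^esub> h) \<and>
     continuous_map T T (\<lambda>g. inv\<^bsub>G\<^esub> g)"

definition continuous_action ::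
  "('g, 'm) monoid_scheme \<Rightarrow> 'g topology \<Rightarrow> 'x topology \<Rightarrow> ('g \<Rightarrow> 'x \<Rightarrow> 'x) \<Rightarrow> bool" where
  "continuous_action G T X \<phi> \<longleftrightarrow>
     group_action G (topspace X) \<phi> \<and>
     continuous_map (prod_topology T X) X (\<lambda>(g, x). \<phi> g x)"

text \<open>The set \<open>X/G\<close> of orbits with the quotient topology.\<close>

definition orbit_space ::
  "('g, 'm) monoid_scheme \<Rightarrow> 'x topology \<Rightarrow> ('g \<Rightarrow> 'x \<Rightarrow> 'x) \<Rightarrow> 'x set topology" where
  "orbit_space G X \<phi> =
     topology (\<lambda>W. W \<subseteq> orbits G (topspace X) \<phi> \<and>
                   openin X {x \<in> topspace X. orbit G \<phi> x \<in> W})"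

lemma openin_orbit_space:
  "openin (orbit_space G X \<phi>) W \<longleftrightarrow>
     W \<subseteq> orbits G (topspace X) \<phi> \<and> openin X {x \<in> topspace X. orbit G \<phi> x \<in> W}"
proof -
  have "istopology (\<lambda>W. W \<subseteq> orbits G (topspace X) \<phi> \<and>
                        openin X {x \<in> topspace X. orbit G \<phi> x \<in> W})"
    unfolding istopology_def
  proof (intro conjI allI impI)
    fix S S'
    assume S: "S \<subseteq> orbits G (topspace X) \<phi> \<and> openin X {x \<in> topspace X. orbit G \<phi> x \<in> S}"
      and S': "S' \<subseteq> orbits G (topspace X) \<phi> \<and> openin X {x \<in> topspace X. orbit G \<phi> x \<in> S'}"
    show "S \<inter> S' \<subseteq> orbits G (topspace X) \<phi>" using S by blast
    have "{x \<in> topspace X. orbit G \<phi> x \<in> S \<inter> S'} =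
          {x \<in> topspace X. orbit G \<phi> x \<in> S} \<inter> {x \<in> topspace X. orbit G \<phi> x \<in> S'}" by blast
    then show "openin X {x \<in> topspace X. orbit G \<phi> x \<in> S \<inter> S'}"
      using S S' by auto
  next
    fix \<K>
    assume K: "\<forall>K\<in>\<K>. K \<subseteq> orbits G (topspace X) \<phi> \<and>
                       openin X {x \<in> topspace X. orbit G \<phi> x \<in> K}"
    show "\<Union>\<K> \<subseteq> orbits G (topspace X) \<phi>" using K by blast
    have "{x \<in> topspace X. orbit G \<phi> x \<in> \<Union>\<K>} =
          (\<Union>K\<in>\<K>. {x \<in> topspace X. orbit G \<phi> x \<in> K})" by blast
    then show "openin X {x \<in> topspace X. orbit G \<phi> x \<in> \<Union>\<K>}"
      using K by auto
  qed
  then show ?thesis by (simp add: orbit_space_def)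
qed

lemma topspace_orbit_space [simp]:
  "topspace (orbit_space G X \<phi>) = orbits G (topspace X) \<phi>"
proof
  show "topspace (orbit_space G X \<phi>) \<subseteq> orbits G (topspace X) \<phi>"
    using openin_orbit_space[of G X \<phi> "topspace (orbit_space G X \<phi>)"] by simp
  have "{x \<in> topspace X. orbit G \<phi> x \<in> orbits G (topspace X) \<phi>} = topspace X"
    unfolding orbits_def by blast
  then have "openin (orbit_space G X \<phi>) (orbits G (topspace X) \<phi>)"
    by (simp add: openin_orbit_space)
  then show "orbits G (topspace X) \<phi> \<subseteq> topspace (orbit_space G X \<phi>)"
    by (rule openin_subset)
qed

lemma quotient_map_orbit_space: "quotient_map X (orbit_space G X \<phi>) (orbit G \<phi>)"
  unfolding quotient_map_def by (auto simp: openin_orbit_space orbits_def)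

definition diagonal_action ::
  "'x topology \<Rightarrow> 'p topology \<Rightarrow> ('g \<Rightarrow> 'x \<Rightarrow> 'x) \<Rightarrow> ('g \<Rightarrow> 'p \<Rightarrow> 'p) \<Rightarrow> 'g \<Rightarrow> 'x \<times> 'p \<Rightarrow> 'x \<times> 'p" where
  "diagonal_action X P \<phi> \<psi> g =
     (\<lambda>z \<in> topspace X \<times> topspace P. (\<phi> g (fst z), \<psi> g (snd z)))"


subsection \<open>Bundles\<close>

text \<open>
  The atlas is indexed by the points of the base, with \<open>b \<in> U b\<close>; every atlas yields one of
  this shape by choosing a chart around each point.  As \<open>G\<close> need not act effectively on
  \<open>X\<close>, the transition functions \<open>\<theta> a b\<close> and their cocycle condition are part of the structure.
\<close>

definition bundle_with_structure_group ::
  "('g, 'm) monoid_scheme \<Rightarrow> 'g topology \<Rightarrow> 'x topology \<Rightarrow> ('g \<Rightarrow> 'x \<Rightarrow> 'x) \<Rightarrow>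
   'e topology \<Rightarrow> 'b topology \<Rightarrow> ('e \<Rightarrow> 'b) \<Rightarrow> bool" where
  "bundle_with_structure_group G T X \<phi> E B p \<longleftrightarrow>
     topological_group G T \<and> continuous_action G T X \<phi> \<and> continuous_map E B p \<and>
     (\<exists>(U :: 'b \<Rightarrow> 'b set) (h :: 'b \<Rightarrow> 'e \<Rightarrow> 'b \<times> 'x) (\<theta> :: 'b \<Rightarrow> 'b \<Rightarrow> 'b \<Rightarrow> 'g).
        (\<forall>b \<in> topspace B.
           openin B (U b) \<and> b \<in> U b \<and>
           homeomorphic_map (subtopology E {e \<in> topspace E. p e \<in> U b})
             (prod_topology (subtopology B (U b)) X) (h b) \<and>
           (\<forall>e \<in> topspace E. p e \<in> U b \<longrightarrow> fst (h b e) = p e)) \<and>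
        (\<forall>a \<in> topspace B. \<forall>b \<in> topspace B.
           continuous_map (subtopology B (U a \<inter> U b)) T (\<theta> a b) \<and>
           (\<forall>e \<in> topspace E. p e \<in> U a \<inter> U b \<longrightarrow>
              snd (h a e) = \<phi> (\<theta> a b (p e)) (snd (h b e)))) \<and>
        (\<forall>a \<in> topspace B. \<forall>b \<in> topspace B. \<forall>c \<in> topspace B. \<forall>z \<in> U a \<inter> U b \<inter> U c.
           \<theta> a b z \<otimes>\<^bsub>G\<^esub> \<theta> b c z = \<theta> a c z))"

text \<open>
  \<open>G\<close> acts on the total space from the left (a right action is turned into a left one by
  \<open>g q = q g\<^sup>-\<^sup>1\<close>), so that the diagonal action on \<open>X \<times> P\<close> makes sense; accordingly the
  local models \<open>U \<times> G\<close> carry left translation.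
\<close>

definition principal_bundle ::
  "('g, 'm) monoid_scheme \<Rightarrow> 'g topology \<Rightarrow> 'p topology \<Rightarrow> ('g \<Rightarrow> 'p \<Rightarrow> 'p) \<Rightarrow>
   'b topology \<Rightarrow> ('p \<Rightarrow> 'b) \<Rightarrow> bool" where
  "principal_bundle G T P \<psi> B \<tau> \<longleftrightarrow>
     topological_group G T \<and> continuous_action G T P \<psi> \<and> continuous_map P B \<tau> \<and>
     (\<forall>g \<in> carrier G. \<forall>q \<in> topspace P. \<tau> (\<psi> g q) = \<tau> q) \<and>
     (\<forall>b \<in> topspace B. \<exists>U h.
        openin B U \<and> b \<in> U \<and>
        homeomorphic_map (subtopology P {q \<in> topspace P. \<tau> q \<in> U})
          (prod_topology (subtopology B U) T) h \<and>
        (\<forall>q \<in> topspace P. \<tau> q \<in> U \<longrightarrow> fst (h q) = \<tau> q) \<and>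
        (\<forall>g \<in> carrier G. \<forall>q \<in> topspace P. \<tau> q \<in> U \<longrightarrow>
           snd (h (\<psi> g q)) = g \<otimes>\<^bsub>G\<^esub> snd (h q)))"

abbreviation associated_space ::
  "('g, 'm) monoid_scheme \<Rightarrow> 'x topology \<Rightarrow> ('g \<Rightarrow> 'x \<Rightarrow> 'x) \<Rightarrow>
   'p topology \<Rightarrow> ('g \<Rightarrow> 'p \<Rightarrow> 'p) \<Rightarrow> ('x \<times> 'p) set topology" where
  "associated_space G X \<phi> P \<psi> \<equiv> orbit_space G (prod_topology X P) (diagonal_action X P \<phi> \<psi>)"

text \<open>
  \<open>p : E \<rightarrow> B\<close> is identified with \<open>(X \<times> P)/G \<rightarrow> P/G = B\<close>, \<open>[x, q] \<mapsto> [q]\<close>, where \<open>P/G\<close> is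
  identified with \<open>B\<close> through \<open>[q] \<mapsto> \<tau> q\<close>.
\<close>

definition is_associated_bundle ::
  "('g, 'm) monoid_scheme \<Rightarrow> 'x topology \<Rightarrow> ('g \<Rightarrow> 'x \<Rightarrow> 'x) \<Rightarrow>
   'p topology \<Rightarrow> ('g \<Rightarrow> 'p \<Rightarrow> 'p) \<Rightarrow> ('p \<Rightarrow> 'b) \<Rightarrow> 'e topology \<Rightarrow> ('e \<Rightarrow> 'b) \<Rightarrow> bool" where
  "is_associated_bundle G X \<phi> P \<psi> \<tau> E p \<longleftrightarrow>
     (\<exists>h. homeomorphic_map (associated_space G X \<phi> P \<psi>) E h \<and>
          (\<forall>x \<in> topspace X. \<forall>q \<in> topspace P.
             p (h (orbit G (diagonal_action X P \<phi> \<psi>) (x, q))) = \<tau> q))"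


subsection \<open>Mapping spaces and powers\<close>

text \<open>Functions are made extensional so that they are determined by their values on the domain.\<close>

definition compact_open_topology :: "'a topology \<Rightarrow> 'b topology \<Rightarrow> ('a \<Rightarrow> 'b) topology" where
  "compact_open_topology X Y =
     topology_generated_by
       {{f \<in> extensional (topspace X). continuous_map X Y f \<and> f ` K \<subseteq> V} | K V.
          compactin X K \<and> openin Y V}"

lemma topspace_compact_open_topology:
  "topspace (compact_open_topology X Y) =
     {f \<in> extensional (topspace X). continuous_map X Y f}"
proof -
  let ?M = "{f \<in> extensional (topspace X). continuous_map X Y f}"
  let ?S = "{{f \<in> extensional (topspace X). continuous_map X Y f \<and> f ` K \<subseteq> V} | K V.
               compactin X K \<and> openin Y V}"
  have "?M = {f \<in> extensional (topspace X). continuous_map X Y f \<and> f ` {} \<subseteq> {}}"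
    by simp
  then have "?M \<in> ?S"
    using compactin_empty[of X] openin_empty[of Y] by blast
  then have "\<Union>?S = ?M"
    by blast
  then show ?thesis
    by (simp add: compact_open_topology_def topology_generated_by_topspace)
qed

abbreviation path_space :: "'a topology \<Rightarrow> (real \<Rightarrow> 'a) topology" where
  "path_space X \<equiv> compact_open_topology (top_of_set {0..1}) X"

abbreviation power_space :: "nat \<Rightarrow> 'a topology \<Rightarrow> (nat \<Rightarrow> 'a) topology" where
  "power_space r X \<equiv> product_topology (\<lambda>_. X) {1..r}"

definition eval_at :: "nat \<Rightarrow> (nat \<Rightarrow> real) \<Rightarrow> (real \<Rightarrow> 'a) \<Rightarrow> nat \<Rightarrow> 'a" where
  "eval_at r t \<gamma> = (\<lambda>i \<in> {1..r}. \<gamma> (t i))"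


subsection \<open>Sectional category and topological complexities\<close>

text \<open>
  The infimum in \<^typ>\<open>enat\<close> of a nonempty set is its least element, that of the empty set is \<open>\<infinity>\<close>.
\<close>

definition secat :: "'e topology \<Rightarrow> 'b topology \<Rightarrow> ('e \<Rightarrow> 'b) \<Rightarrow> enat" where
  "secat E B q = Inf {enat k | k. \<exists>U :: nat \<Rightarrow> 'b set.
     (\<forall>i\<le>k. openin B (U i)) \<and> (\<Union>i\<le>k. U i) = topspace B \<and>
     (\<forall>i\<le>k. \<exists>s. continuous_map (subtopology B (U i)) E s \<and> (\<forall>b \<in> U i. q (s b) = b))}"

definition fibrewise_power ::
  "nat \<Rightarrow> 'e topology \<Rightarrow> ('e \<Rightarrow> 'b) \<Rightarrow> (nat \<Rightarrow> 'e) topology" where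
  "fibrewise_power r E p =
     subtopology (power_space r E) {e. \<forall>i \<in> {1..r}. \<forall>j \<in> {1..r}. p (e i) = p (e j)}"

definition fibrewise_path_space :: "'e topology \<Rightarrow> ('e \<Rightarrow> 'b) \<Rightarrow> (real \<Rightarrow> 'e) topology" where
  "fibrewise_path_space E p =
     subtopology (path_space E) {\<gamma>. \<exists>b. \<forall>s \<in> {0..1}. p (\<gamma> s) = b}"

text \<open>
  The evaluation times \<open>t 1 < \<dots> < t r\<close> are explicit
  parameters of both invariants.
\<close>

definition parametrized_TC ::
  "nat \<Rightarrow> (nat \<Rightarrow> real) \<Rightarrow> 'e topology \<Rightarrow> ('e \<Rightarrow> 'b) \<Rightarrow> enat" where
  "parametrized_TC r t E p =
     secat (fibrewise_path_space E p) (fibrewise_power r E p) (eval_at r t)"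

definition power_action :: "nat \<Rightarrow> ('g \<Rightarrow> 'x \<Rightarrow> 'x) \<Rightarrow> 'g \<Rightarrow> (nat \<Rightarrow> 'x) \<Rightarrow> (nat \<Rightarrow> 'x)" where
  "power_action r \<phi> g x = (\<lambda>i \<in> {1..r}. \<phi> g (x i))"

definition path_action :: "('g \<Rightarrow> 'x \<Rightarrow> 'x) \<Rightarrow> 'g \<Rightarrow> (real \<Rightarrow> 'x) \<Rightarrow> (real \<Rightarrow> 'x)" where
  "path_action \<phi> g \<gamma> = (\<lambda>s \<in> {0..1}. \<phi> g (\<gamma> s))"

definition equivariant_TC ::
  "nat \<Rightarrow> (nat \<Rightarrow> real) \<Rightarrow> ('g, 'm) monoid_scheme \<Rightarrow> 'x topology \<Rightarrow> ('g \<Rightarrow> 'x \<Rightarrow> 'x) \<Rightarrow> enat" where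
  "equivariant_TC r t G X \<phi> = Inf {enat k | k. \<exists>U :: nat \<Rightarrow> (nat \<Rightarrow> 'x) set.
     (\<forall>i\<le>k. openin (power_space r X) (U i)) \<and>
     (\<Union>i\<le>k. U i) = topspace (power_space r X) \<and>
     (\<forall>i\<le>k. \<forall>g \<in> carrier G. \<forall>x \<in> U i. power_action r \<phi> g x \<in> U i) \<and>
     (\<forall>i\<le>k. \<exists>s. continuous_map (subtopology (power_space r X) (U i)) (path_space X) s \<and>
        (\<forall>x \<in> U i. eval_at r t (s x) = x) \<and>
        (\<forall>g \<in> carrier G. \<forall>x \<in> U i. s (power_action r \<phi> g x) = path_action \<phi> g (s x)))}"

end

theory Submission
  imports Defs
begin

text \<open>
  The map \<open>X\<^sup>r \<times> P \<rightarrow> E\<^sup>r\<^sub>B\<close>, \<open>(x, q) \<mapsto> ([x\<^sub>1, q], \<dots>, [x\<^sub>r, q])\<close>, has local sections coming from the charts of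
  the principal bundle, so it is a quotient map; since \<open>G\<close> acts freely on \<open>P\<close>, its fibres are
  exactly the orbits of the diagonal action.  Hence an invariant open set \<open>U \<subseteq> X\<^sup>r\<close> yields an open set
  in \<open>E\<^sup>r\<^sub>B\<close>, the image of \<open>U \<times> P\<close>, and for an equivariant section \<open>s\<close> over \<open>U\<close> the continuous map
  \<open>(x, q) \<mapsto> (u \<mapsto> [s(x)(u), q])\<close> descends to a section over that image.  The two systems of
  evaluation times are matched by precomposing paths with a self-map of the unit interval
  carrying one to the other.
\<close>

section \<open>Currying and evaluation in the compact-open topology\<close>

text \<open>Continuity need only be tested on the generating sets given by a compact
  \<open>K\<close> and an open \<open>V\<close>. If \<open>F\<close> sends
  \<open>{w} \<times> K\<close> into \<open>V\<close>, the tube lemma thickens \<open>w\<close> to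
  an open \<open>A\<close> for which \<open>A \<times> K\<close> still goes into \<open>V\<close>.
  Continuity of the descended section into the path space of \<open>E\<close> comes from
  here.\<close>

lemma continuous_map_curry_compact_open:
  assumes F: "continuous_map (prod_topology W Z) Y F"
  shows "continuous_map W (compact_open_topology Z Y) (\<lambda>w. \<lambda>z \<in> topspace Z. F (w, z))"
proof -
  let ?c = "\<lambda>w. \<lambda>z \<in> topspace Z. F (w, z)"
  have cont: "continuous_map Z Y (?c w)" if "w \<in> topspace W" for w
  proof -
    have "continuous_map Z Y (F \<circ> (\<lambda>z. (w, z)))"
      using that by (intro continuous_map_compose[OF _ F] continuous_map_pairedI) auto
    then show ?thesis
      by (rule continuous_map_eq) auto
  qed
  have "openin W {w \<in> topspace W. ?c w ` K \<subseteq> V}" if K: "compactin Z K" and V: "openin Y V" for K V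
  proof (subst openin_subopen, intro ballI)
    fix w assume w: "w \<in> {w \<in> topspace W. ?c w ` K \<subseteq> V}"
    let ?N = "{y \<in> topspace (prod_topology W Z). F y \<in> V}"
    have sub: "K \<subseteq> topspace Z"
      using K by (rule compactin_subset_topspace)
    have "openin (prod_topology W Z) ?N"
      using F V by (rule openin_continuous_map_preimage)
    moreover have "{w} \<times> K \<subseteq> ?N"
      using w sub by (auto simp: image_subset_iff)
    ultimately obtain A C where "openin W A" "w \<in> A" "K \<subseteq> C" "A \<times> C \<subseteq> ?N"
      using tube_lemma_right[OF _ K, of W ?N w] w by blast
    then show "\<exists>A. openin W A \<and> w \<in> A \<and> A \<subseteq> {w \<in> topspace W. ?c w ` K \<subseteq> V}"
      using sub openin_subset[of W A] by (intro exI[of _ A]) (auto simp: image_subset_iff subset_iff)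
  qed
  \<comment> \<open>Every \<open>?c w\<close> is extensional and continuous, so membership in a
    generating set reduces to the condition on \<open>K\<close> and \<open>V\<close>.\<close>
  moreover have "?c -` {f \<in> extensional (topspace Z). continuous_map Z Y f \<and> f ` K \<subseteq> V} \<inter> topspace W
      = {w \<in> topspace W. ?c w ` K \<subseteq> V}" for K V
    using cont by auto
  moreover have "?c ` topspace W \<subseteq> topspace (compact_open_topology Z Y)"
    using cont by (auto simp: topspace_compact_open_topology)
  ultimately show ?thesis
    unfolding compact_open_topology_def
    by (intro continuous_on_generated_topo) (auto simp del: vimage_Collect_eq)
qed

text \<open>Local compactness of \<open>Z\<close> is what makes evaluation jointly continuous: a
  compact neighbourhood of \<open>z\<close> inside the preimage of \<open>V\<close> under
  \<open>f\<close> defines a generating open set around \<open>f\<close>, all of whose members map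
  that neighbourhood into \<open>V\<close>.\<close>

lemma continuous_map_eval_compact_open:
  assumes Z: "neighbourhood_base_of (compactin Z) Z"
  shows "continuous_map (prod_topology (compact_open_topology Z Y) Z) Y (\<lambda>(f, z). f z)"
  unfolding continuous_map_def
proof (intro conjI allI impI)
  let ?C = "compact_open_topology Z Y"
  show "(\<lambda>(f, z). f z) \<in> topspace (prod_topology ?C Z) \<rightarrow> topspace Y"
    by (auto simp: topspace_compact_open_topology continuous_map_def)
  fix V assume V: "openin Y V"
  show "openin (prod_topology ?C Z) {y \<in> topspace (prod_topology ?C Z). (case y of (f, z) \<Rightarrow> f z) \<in> V}"
    unfolding openin_prod_topology_alt
  proof (intro allI impI)
    fix f z
    assume "(f, z) \<in> {y \<in> topspace (prod_topology ?C Z). (case y of (f, z) \<Rightarrow> f z) \<in> V}"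
    then have f: "f \<in> extensional (topspace Z)" "continuous_map Z Y f" "z \<in> topspace Z" "f z \<in> V"
      by (auto simp: topspace_compact_open_topology)
    have "openin Z {z \<in> topspace Z. f z \<in> V}"
      using f(2) V by (rule openin_continuous_map_preimage)
    with Z f obtain A K where AK: "openin Z A" "compactin Z K" "z \<in> A" "A \<subseteq> K"
        "K \<subseteq> {z \<in> topspace Z. f z \<in> V}"
      unfolding neighbourhood_base_of by (metis (mono_tags, lifting) mem_Collect_eq)
    define D where "D = {f \<in> extensional (topspace Z). continuous_map Z Y f \<and> f ` K \<subseteq> V}"
    have "openin ?C D"
      unfolding compact_open_topology_def D_def
      using AK V by (intro topology_generated_by_Basis) blast
    moreover have "f \<in> D"
      using f AK by (auto simp: D_def)
    moreover have "D \<times> A \<subseteq> {y \<in> topspace (prod_topology ?C Z). (case y of (f, z) \<Rightarrow> f z) \<in> V}"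
    proof -
      have "f b \<in> V" if "f \<in> D" "b \<in> A" for f b
        using that AK(4) by (auto simp: D_def image_subset_iff)
      moreover have "D \<subseteq> topspace ?C"
        by (auto simp: D_def topspace_compact_open_topology)
      ultimately show ?thesis
        using openin_subset[OF AK(1)] by auto
    qed
    ultimately show "\<exists>D A. openin ?C D \<and> openin Z A \<and> f \<in> D \<and> z \<in> A \<and>
        D \<times> A \<subseteq> {y \<in> topspace (prod_topology ?C Z). (case y of (f, z) \<Rightarrow> f z) \<in> V}"
      using AK by blast
  qed
qed

section \<open>Quotient maps\<close>

text \<open>If the preimage of \<open>A\<close> under \<open>f\<close> is open, pulling it back
  along a local section \<open>s\<close> over \<open>V\<close> gives exactly
  \<open>A \<inter> V\<close>, because \<open>f \<circ> s\<close> is the identity on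
  \<open>V\<close>. So \<open>A\<close> is open near each of its points.\<close>

lemma quotient_map_if_local_sections:
  assumes f: "continuous_map X Y f"
    and sections: "\<And>y. y \<in> topspace Y \<Longrightarrow>
      \<exists>V s. openin Y V \<and> y \<in> V \<and> continuous_map (subtopology Y V) X s \<and> (\<forall>v \<in> V. f (s v) = v)"
  shows "quotient_map X Y f"
  unfolding quotient_map_def
proof (intro conjI allI impI)
  have sur: "y \<in> f ` topspace X" if y: "y \<in> topspace Y" for y
  proof -
    obtain V s where "openin Y V" "y \<in> V" "continuous_map (subtopology Y V) X s" "f (s y) = y"
      using sections[OF y] by metis
    moreover then have "s y \<in> topspace X"
      using y by (auto simp: continuous_map_def)
    ultimately show ?thesis
      by (metis imageI)
  qed
  then show "f ` topspace X = topspace Y"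
    using f by (auto simp: continuous_map_def)
  fix A assume A: "A \<subseteq> topspace Y"
  show "openin X {x \<in> topspace X. f x \<in> A} = openin Y A"
  proof
    assume op: "openin X {x \<in> topspace X. f x \<in> A}"
    show "openin Y A"
    proof (subst openin_subopen, intro ballI)
      fix y assume y: "y \<in> A"
      then obtain V s where V: "openin Y V" "y \<in> V" and s: "continuous_map (subtopology Y V) X s"
        and fs: "\<forall>v \<in> V. f (s v) = v"
        using sections A by (meson subsetD)
      have "openin (subtopology Y V) {v \<in> topspace (subtopology Y V). s v \<in> {x \<in> topspace X. f x \<in> A}}"
        using s op by (rule openin_continuous_map_preimage)
      moreover have "{v \<in> topspace (subtopology Y V). s v \<in> {x \<in> topspace X. f x \<in> A}} = A \<inter> V"
        using s fs A by (auto simp: continuous_map_def)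
      ultimately have "openin Y (A \<inter> V)"
        using V by (simp add: openin_open_subtopology)
      then show "\<exists>T. openin Y T \<and> y \<in> T \<and> T \<subseteq> A"
        using y V by blast
    qed
  qed (use f in \<open>simp add: openin_continuous_map_preimage\<close>)
qed

lemma quotient_map_factor_exists:
  assumes "quotient_map X Y f" "continuous_map X Z h"
    and "\<forall>x \<in> topspace X. \<forall>x' \<in> topspace X. f x = f x' \<longrightarrow> h x = h x'"
  shows "\<exists>g. continuous_map Y Z g \<and> (\<forall>x \<in> topspace X. g (f x) = h x)"
proof -
  have "h x = h x'" if "x \<in> topspace X" "x' \<in> topspace X" "f x = f x'" for x x'
    using assms(3) that by blast
  then show ?thesis
  proof (rule quotient_map_lift_exists[OF assms(1,2)])
    fix g assume "continuous_map Y Z g" "\<And>x. x \<in> topspace X \<Longrightarrow> g (f x) = h x"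
    then show ?thesis
      by (intro exI[of _ g]) simp
  qed
qed

section \<open>Reparametrization and local compactness of the unit interval\<close>

text \<open>A finite set of times is closed in the interval and every function on it is continuous,
  so the assignment \<open>t i \<mapsto> t' i\<close>, well defined by injectivity of
  \<open>t\<close>, extends by Tietze with values kept in the interval.\<close>

lemma reparametrization_exists:
  fixes t t' :: "'i \<Rightarrow> real"
  assumes "finite I" "inj_on t I" "t ` I \<subseteq> {0..1}" "t' ` I \<subseteq> {0..1}"
  obtains \<sigma> where "continuous_map (top_of_set {0..1}) (top_of_set {0..1::real}) \<sigma>"
    "\<And>i. i \<in> I \<Longrightarrow> \<sigma> (t i) = t' i"
proof -
  let ?f = "\<lambda>u. t' (the_inv_into I t u)"
  have f: "?f (t i) = t' i" if "i \<in> I" for i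
    using assms that by (simp add: the_inv_into_f_f)
  obtain g where "continuous_on {0..1} g" "\<And>u. u \<in> t ` I \<Longrightarrow> g u = ?f u"
      "\<And>u. u \<in> {0..1} \<Longrightarrow> g u \<in> cbox 0 (1::real)"
  proof (rule Tietze_closed_interval_1)
    show "continuous_on (t ` I) ?f"
      using assms by (intro continuous_on_finite) auto
    show "closedin (top_of_set {0..1}) (t ` I)"
      using assms by (auto simp: closedin_closed_eq intro: finite_imp_closed)
    show "?f u \<in> cbox 0 1" if "u \<in> t ` I" for u
      using that f assms(4) by auto
  qed auto
  then show thesis
    using f by (intro that[of g]) auto
qed

lemma neighbourhood_base_of_compactin_unit_interval:
  "neighbourhood_base_of (compactin (top_of_set {0..1::real})) (top_of_set {0..1})"
  by (intro locally_compact_imp_neighbourhood_base compact_imp_locally_compact_space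
      regular_space_subtopology regular_space_euclidean)
    (simp add: compact_space_subtopology compactin_subtopology)

section \<open>Associated bundles: free action, local sections, fibre coordinates\<close>

text \<open>\<open>\<kappa>\<close> stands for \<open>(x, q) \<mapsto> [x, q]\<close>, already
  composed with the identification of the orbit space with \<open>E\<close>. The argument uses this
  map only through being a quotient map, having the diagonal orbits as fibres, and lying over
  \<open>\<tau>\<close>.\<close>

locale associated_bundle =
  fixes G :: "('g, 'm) monoid_scheme" and T :: "'g topology"
    and X :: "'x topology" and \<phi> :: "'g \<Rightarrow> 'x \<Rightarrow> 'x"
    and P :: "'p topology" and \<psi> :: "'g \<Rightarrow> 'p \<Rightarrow> 'p"
    and E :: "'e topology" and B :: "'b topology"
    and p :: "'e \<Rightarrow> 'b" and \<tau> :: "'p \<Rightarrow> 'b" and \<kappa> :: "'x \<times> 'p \<Rightarrow> 'e"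
  assumes action: "continuous_action G T X \<phi>"
    and principal: "principal_bundle G T P \<psi> B \<tau>"
    and proj: "continuous_map E B p"
    and quotient: "quotient_map (prod_topology X P) E \<kappa>"
    and class_eq_iff: "\<And>x q x' q'. \<lbrakk>x \<in> topspace X; q \<in> topspace P; x' \<in> topspace X; q' \<in> topspace P\<rbrakk> \<Longrightarrow>
      \<kappa> (x, q) = \<kappa> (x', q') \<longleftrightarrow> (\<exists>g \<in> carrier G. x' = \<phi> g x \<and> q' = \<psi> g q)"
    and proj_class: "\<And>x q. \<lbrakk>x \<in> topspace X; q \<in> topspace P\<rbrakk> \<Longrightarrow> p (\<kappa> (x, q)) = \<tau> q"
begin

sublocale group G
  using principal by (simp add: principal_bundle_def topological_group_def)

sublocale X: group_action G "topspace X" \<phi>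
  using action by (simp add: continuous_action_def)

sublocale P: group_action G "topspace P" \<psi>
  using principal by (simp add: principal_bundle_def continuous_action_def)

lemma topspace_group: "topspace T = carrier G"
  using principal by (simp add: principal_bundle_def topological_group_def)

lemma continuous_map_inv: "continuous_map T T (\<lambda>g. inv\<^bsub>G\<^esub> g)"
  using principal by (simp add: principal_bundle_def topological_group_def)

lemma continuous_map_principal_proj: "continuous_map P B \<tau>"
  using principal by (simp add: principal_bundle_def)

lemma principal_proj_action: "\<lbrakk>g \<in> carrier G; q \<in> topspace P\<rbrakk> \<Longrightarrow> \<tau> (\<psi> g q) = \<tau> q"
  using principal by (simp add: principal_bundle_def)

lemma fibre_action_closed: "\<lbrakk>g \<in> carrier G; x \<in> topspace X\<rbrakk> \<Longrightarrow> \<phi> g x \<in> topspace X"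
  using X.element_image by blast

lemma principal_action_closed: "\<lbrakk>g \<in> carrier G; q \<in> topspace P\<rbrakk> \<Longrightarrow> \<psi> g q \<in> topspace P"
  using P.element_image by blast

lemma continuous_map_action:
  assumes "continuous_map Z T f" "continuous_map Z X u"
  shows "continuous_map Z X (\<lambda>z. \<phi> (f z) (u z))"
proof -
  have "continuous_map (prod_topology T X) X (\<lambda>(g, x). \<phi> g x)"
    using action by (simp add: continuous_action_def)
  from continuous_map_compose[OF continuous_map_pairedI[OF assms] this]
  show ?thesis
    by (simp add: o_def)
qed

lemma local_trivialization:
  assumes "b \<in> topspace B"
  obtains V h k where "openin B V" "b \<in> V"
    "homeomorphic_maps (subtopology P {q \<in> topspace P. \<tau> q \<in> V}) (prod_topology (subtopology B V) T) h k"
    "\<And>q. \<lbrakk>q \<in> topspace P; \<tau> q \<in> V\<rbrakk> \<Longrightarrow> fst (h q) = \<tau> q"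
    "\<And>g q. \<lbrakk>g \<in> carrier G; q \<in> topspace P; \<tau> q \<in> V\<rbrakk> \<Longrightarrow> snd (h (\<psi> g q)) = g \<otimes>\<^bsub>G\<^esub> snd (h q)"
proof -
  note charts = principal[unfolded principal_bundle_def, THEN conjunct2, THEN conjunct2, THEN conjunct2, THEN conjunct2]
  from bspec[OF charts assms] obtain V h where V: "openin B V" "b \<in> V"
    and h: "homeomorphic_map (subtopology P {q \<in> topspace P. \<tau> q \<in> V}) (prod_topology (subtopology B V) T) h"
    and eq: "\<forall>q \<in> topspace P. \<tau> q \<in> V \<longrightarrow> fst (h q) = \<tau> q"
      "\<forall>g \<in> carrier G. \<forall>q \<in> topspace P. \<tau> q \<in> V \<longrightarrow> snd (h (\<psi> g q)) = g \<otimes>\<^bsub>G\<^esub> snd (h q)"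
    by (elim exE conjE) (rule that)
  from h obtain k where
    "homeomorphic_maps (subtopology P {q \<in> topspace P. \<tau> q \<in> V}) (prod_topology (subtopology B V) T) h k"
    unfolding homeomorphic_map_maps by (rule exE)
  then show thesis
    by (rule that[OF V]) (use eq in auto)
qed

text \<open>In a chart around \<open>\<tau> q\<close> the action is left translation on the group
  coordinate, where cancellation applies.\<close>

lemma action_free:
  assumes "g \<in> carrier G" "g' \<in> carrier G" and q: "q \<in> topspace P" and "\<psi> g q = \<psi> g' q"
  shows "g = g'"
proof -
  have "\<tau> q \<in> topspace B"
    using q continuous_map_principal_proj by (auto simp: continuous_map_def)
  then obtain V h k where V: "\<tau> q \<in> V"
    and h: "homeomorphic_maps (subtopology P {q \<in> topspace P. \<tau> q \<in> V})
              (prod_topology (subtopology B V) T) h k"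
    and snd: "\<And>g q. \<lbrakk>g \<in> carrier G; q \<in> topspace P; \<tau> q \<in> V\<rbrakk> \<Longrightarrow> snd (h (\<psi> g q)) = g \<otimes>\<^bsub>G\<^esub> snd (h q)"
    by (rule local_trivialization) (rule that, (assumption | simp)+)
  have "h q \<in> topspace (prod_topology (subtopology B V) T)"
    using h q V unfolding homeomorphic_maps_def continuous_map_def by auto
  then have "snd (h q) \<in> carrier G"
    by (auto simp: topspace_group)
  moreover have "g \<otimes>\<^bsub>G\<^esub> snd (h q) = g' \<otimes>\<^bsub>G\<^esub> snd (h q)"
    using snd[OF assms(1) q V] snd[OF assms(2) q V] assms(4) by argo
  ultimately show ?thesis
    using assms(1,2) right_cancel by blast
qed

text \<open>\<open>\<sigma>\<close> is the section whose group coordinate in the chart is the unit,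
  and \<open>\<gamma>\<close> is the group coordinate itself. It measures how far \<open>q\<close>
  is from \<open>\<sigma> (\<tau> q)\<close> in its fibre.\<close>

lemma local_section:
  assumes "b \<in> topspace B"
  obtains V \<sigma> \<gamma> where "openin B V" "b \<in> V"
    "continuous_map (subtopology B V) P \<sigma>" "\<And>v. v \<in> V \<Longrightarrow> \<tau> (\<sigma> v) = v"
    "continuous_map (subtopology P {q \<in> topspace P. \<tau> q \<in> V}) T \<gamma>"
    "\<And>q. \<lbrakk>q \<in> topspace P; \<tau> q \<in> V\<rbrakk> \<Longrightarrow> \<psi> (\<gamma> q) (\<sigma> (\<tau> q)) = q"
proof -
  obtain V h k where V: "openin B V" "b \<in> V"
    and hk: "homeomorphic_maps (subtopology P {q \<in> topspace P. \<tau> q \<in> V})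
              (prod_topology (subtopology B V) T) h k"
    and fst: "\<And>q. \<lbrakk>q \<in> topspace P; \<tau> q \<in> V\<rbrakk> \<Longrightarrow> fst (h q) = \<tau> q"
    and snd: "\<And>g q. \<lbrakk>g \<in> carrier G; q \<in> topspace P; \<tau> q \<in> V\<rbrakk> \<Longrightarrow> snd (h (\<psi> g q)) = g \<otimes>\<^bsub>G\<^esub> snd (h q)"
    by (rule local_trivialization[OF assms]) (rule that, (assumption | simp)+)
  let ?P = "subtopology P {q \<in> topspace P. \<tau> q \<in> V}"
  have sub: "V \<subseteq> topspace B"
    using V by (simp add: openin_subset)
  have h: "continuous_map ?P (prod_topology (subtopology B V) T) h"
    and k: "continuous_map (prod_topology (subtopology B V) T) ?P k"
    and kh: "\<And>q. \<lbrakk>q \<in> topspace P; \<tau> q \<in> V\<rbrakk> \<Longrightarrow> k (h q) = q"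
    and hk: "\<And>v g. \<lbrakk>v \<in> V; g \<in> carrier G\<rbrakk> \<Longrightarrow> h (k (v, g)) = (v, g)"
    using hk sub by (auto simp: homeomorphic_maps_def topspace_group subset_iff)
  define \<sigma> where "\<sigma> = (\<lambda>v. k (v, \<one>\<^bsub>G\<^esub>))"
  have \<sigma>: "continuous_map (subtopology B V) ?P \<sigma>"
    using continuous_map_compose[OF _ k, of "subtopology B V" "\<lambda>v. (v, \<one>\<^bsub>G\<^esub>)"]
    by (auto simp: \<sigma>_def o_def continuous_map_pairwise topspace_group)
  then have \<sigma>_in: "\<sigma> v \<in> topspace P" "\<tau> (\<sigma> v) \<in> V" if "v \<in> V" for v
    using that sub by (auto simp: continuous_map_def)
  have h\<sigma>: "h (\<sigma> v) = (v, \<one>\<^bsub>G\<^esub>)" if "v \<in> V" for v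
    using that hk by (simp add: \<sigma>_def)
  have \<tau>\<sigma>: "\<tau> (\<sigma> v) = v" if "v \<in> V" for v
    using fst \<sigma>_in h\<sigma> that by (metis fst_conv)
  have \<gamma>: "continuous_map ?P T (snd \<circ> h)"
    using h by (simp add: continuous_map_pairwise)
  show thesis
  proof (rule that[OF V _ \<tau>\<sigma> \<gamma>])
    show "continuous_map (subtopology B V) P \<sigma>"
      using \<sigma> by (simp add: continuous_map_in_subtopology)
    fix q assume q: "q \<in> topspace P" "\<tau> q \<in> V"
    let ?g = "snd (h q)"
    have g: "?g \<in> carrier G"
      using \<gamma> q by (auto simp: continuous_map_def topspace_group)
    let ?q = "\<psi> ?g (\<sigma> (\<tau> q))"
    have q': "?q \<in> topspace P" "\<tau> ?q = \<tau> q"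
      using g q \<sigma>_in \<tau>\<sigma> by (auto simp: principal_action_closed principal_proj_action)
    then have "fst (h ?q) = fst (h q)"
      using fst q by simp
    moreover have "snd (h ?q) = snd (h q)"
      using snd[OF g] \<sigma>_in h\<sigma> q g by simp
    \<comment> \<open>The translate of \<open>\<sigma> (\<tau> q)\<close> and \<open>q\<close> agree
      in both chart coordinates, so they are equal by injectivity of the chart.\<close>
    ultimately have "h ?q = h q"
      by (rule prod_eqI)
    then show "\<psi> ((snd \<circ> h) q) (\<sigma> (\<tau> q)) = q"
      using kh q q' by (metis comp_apply)
  qed
qed

lemma class_in_topspace: "\<lbrakk>x \<in> topspace X; q \<in> topspace P\<rbrakk> \<Longrightarrow> \<kappa> (x, q) \<in> topspace E"
  using quotient_imp_surjective_map[OF quotient] by force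

lemma class_action:
  assumes "g \<in> carrier G" "x \<in> topspace X" "q \<in> topspace P"
  shows "\<kappa> (\<phi> g x, \<psi> g q) = \<kappa> (x, q)"
  using assms class_eq_iff[of x q "\<phi> g x" "\<psi> g q"] by (auto simp: fibre_action_closed principal_action_closed)

text \<open>Over \<open>V\<close> each class \<open>[x, q]\<close> can be normalized so that its
  second entry lies on the section \<open>\<sigma>\<close>: acting by the inverse of
  \<open>\<gamma> q\<close> turns \<open>q\<close> into \<open>\<sigma> (\<tau> q)\<close> and
  \<open>x\<close> into the fibre coordinate \<open>\<xi>\<close>. Continuity of
  \<open>\<xi>\<close> is obtained by descending the formula \<open>f\<close> along
  \<open>\<kappa>\<close>.\<close>

lemma local_fibre_coordinate:
  assumes "b \<in> topspace B"
  obtains V \<sigma> \<xi> where "openin B V" "b \<in> V" "continuous_map (subtopology B V) P \<sigma>"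
    "continuous_map (subtopology E {e \<in> topspace E. p e \<in> V}) X \<xi>"
    "\<And>e. \<lbrakk>e \<in> topspace E; p e \<in> V\<rbrakk> \<Longrightarrow> \<kappa> (\<xi> e, \<sigma> (p e)) = e"
proof -
  obtain V \<sigma> \<gamma> where V: "openin B V" "b \<in> V"
    and \<sigma>: "continuous_map (subtopology B V) P \<sigma>" "\<And>v. v \<in> V \<Longrightarrow> \<tau> (\<sigma> v) = v"
    and \<gamma>: "continuous_map (subtopology P {q \<in> topspace P. \<tau> q \<in> V}) T \<gamma>"
    and \<gamma>\<sigma>: "\<And>q. \<lbrakk>q \<in> topspace P; \<tau> q \<in> V\<rbrakk> \<Longrightarrow> \<psi> (\<gamma> q) (\<sigma> (\<tau> q)) = q"
    by (rule local_section[OF assms]) (rule that, (assumption | simp)+)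
  have \<sigma>_in: "\<sigma> v \<in> topspace P" if "v \<in> V" for v
    using \<sigma> that openin_subset[OF V(1)] by (auto simp: continuous_map_def)
  have \<gamma>_in: "\<gamma> q \<in> carrier G" if "q \<in> topspace P" "\<tau> q \<in> V" for q
    using \<gamma> that by (auto simp: continuous_map_def topspace_group)
  let ?E = "{e \<in> topspace E. p e \<in> V}" and ?S = "{z \<in> topspace (prod_topology X P). \<tau> (snd z) \<in> V}"
  let ?XP = "subtopology (prod_topology X P) ?S"
  define f where "f z = \<phi> (inv\<^bsub>G\<^esub> (\<gamma> (snd z))) (fst z)" for z
  have "openin E ?E"
    using proj V(1) by (rule openin_continuous_map_preimage)
  \<comment> \<open>\<open>?S\<close> is the full preimage of the open set \<open>?E\<close>, since
    \<open>\<kappa>\<close> lies over \<open>\<tau>\<close>; over an open set a quotient map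
    restricts to a quotient map.\<close>
  then have quot: "quotient_map ?XP (subtopology E ?E) \<kappa>"
    using quotient by (intro quotient_map_restriction) (auto simp: class_in_topspace proj_class)
  have "continuous_map ?XP (subtopology P {q \<in> topspace P. \<tau> q \<in> V}) snd"
    by (auto simp: continuous_map_in_subtopology intro: continuous_map_from_subtopology continuous_map_snd)
  from continuous_map_compose[OF continuous_map_compose[OF this \<gamma>] continuous_map_inv]
  have f: "continuous_map ?XP X f"
    unfolding f_def
    by (intro continuous_map_action) (auto simp: o_def intro: continuous_map_from_subtopology continuous_map_fst)
  have f_eq: "f (x, q) = f (x', q')"
    if z: "x \<in> topspace X" "q \<in> topspace P" "\<tau> q \<in> V" "x' \<in> topspace X" "q' \<in> topspace P"
      "\<kappa> (x, q) = \<kappa> (x', q')" for x q x' q'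
  proof -
    obtain g where g: "g \<in> carrier G" "x' = \<phi> g x" "q' = \<psi> g q"
      using z(6) class_eq_iff[OF z(1,2,4,5)] by blast
    have \<tau>: "\<tau> q' = \<tau> q"
      using g z principal_proj_action by metis
    \<comment> \<open>Both sides equal \<open>q' = \<psi> g q\<close>. Freeness then shows that
      \<open>\<gamma>\<close> is equivariant, and the factor \<open>g\<close> cancels in
      \<open>f\<close>.\<close>
    have "\<psi> (\<gamma> q') (\<sigma> (\<tau> q)) = \<psi> g (\<psi> (\<gamma> q) (\<sigma> (\<tau> q)))"
      using \<gamma>\<sigma>[OF z(2,3)] \<gamma>\<sigma>[OF z(5)] \<tau> z(3) g(3) by metis
    also have "\<dots> = \<psi> (g \<otimes>\<^bsub>G\<^esub> \<gamma> q) (\<sigma> (\<tau> q))"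
      by (rule P.composition_rule[symmetric, OF \<sigma>_in[OF z(3)] g(1) \<gamma>_in[OF z(2,3)]])
    finally have *: "\<gamma> q' = g \<otimes>\<^bsub>G\<^esub> \<gamma> q"
      using z(2,3,5) g(1) \<gamma>_in \<tau> by (intro action_free[OF _ _ \<sigma>_in[OF z(3)]]) auto
    have "\<phi> (inv\<^bsub>G\<^esub> (\<gamma> q')) x' = \<phi> (inv\<^bsub>G\<^esub> (\<gamma> q)) (\<phi> (inv\<^bsub>G\<^esub> g) x')"
      using z(2-4) g(1) \<gamma>_in by (simp add: * inv_mult_group X.composition_rule)
    also have "\<phi> (inv\<^bsub>G\<^esub> g) x' = x"
      using g z by (simp add: X.orbit_sym_aux)
    finally show ?thesis
      by (simp add: f_def)
  qed
  have f_eq': "\<forall>z \<in> topspace ?XP. \<forall>z' \<in> topspace ?XP. \<kappa> z = \<kappa> z' \<longrightarrow> f z = f z'"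
  proof (intro ballI impI)
    fix z z' assume "z \<in> topspace ?XP" "z' \<in> topspace ?XP" "\<kappa> z = \<kappa> z'"
    then show "f z = f z'"
      using f_eq[of "fst z" "snd z" "fst z'" "snd z'"] by (simp add: mem_Times_iff)
  qed
  from quotient_map_factor_exists[OF quot f f_eq']
  obtain \<xi> where \<xi>: "continuous_map (subtopology E ?E) X \<xi>" "\<forall>z \<in> topspace ?XP. \<xi> (\<kappa> z) = f z"
    by (elim exE conjE) (rule that)
  show thesis
  proof (rule that[OF V \<sigma>(1) \<xi>(1)])
    fix e assume e: "e \<in> topspace E" "p e \<in> V"
    have "e \<in> \<kappa> ` topspace (prod_topology X P)"
      using e(1) quotient_imp_surjective_map[OF quotient] by simp
    then obtain x q where xq: "x \<in> topspace X" "q \<in> topspace P" "e = \<kappa> (x, q)"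
      by auto
    have \<tau>: "\<tau> q \<in> V" "p e = \<tau> q"
      using e xq by (auto simp: proj_class)
    have "\<xi> e = \<phi> (inv\<^bsub>G\<^esub> (\<gamma> q)) x"
      using bspec[OF \<xi>(2), of "(x, q)"] xq \<tau> by (simp add: f_def)
    moreover have "\<sigma> (p e) = \<psi> (inv\<^bsub>G\<^esub> (\<gamma> q)) q"
      using \<gamma>\<sigma>[of q] P.orbit_sym_aux[of "\<gamma> q" "\<sigma> (\<tau> q)"] xq \<tau> \<gamma>_in \<sigma>_in by simp
    ultimately show "\<kappa> (\<xi> e, \<sigma> (p e)) = e"
      using class_action[of "inv\<^bsub>G\<^esub> (\<gamma> q)" x q] xq \<tau> \<gamma>_in by simp
  qed
qed

section \<open>The quotient map from \<open>X^r \<times> P\<close> to the fibrewise power\<close>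

definition tuple_class :: "nat \<Rightarrow> (nat \<Rightarrow> 'x) \<times> 'p \<Rightarrow> nat \<Rightarrow> 'e" where
  "tuple_class r = (\<lambda>(x, q). \<lambda>i \<in> {1..r}. \<kappa> (x i, q))"

text \<open>Equality in each coordinate gives a group element \<open>g i\<close> that may depend on
  \<open>i\<close>. All of them send \<open>q\<close> to \<open>q'\<close>, so freeness on
  \<open>P\<close> makes them coincide. The bound on \<open>r\<close> guarantees an index, without
  which \<open>q\<close> and \<open>q'\<close> would be unrelated.\<close>

lemma tuple_class_eqD:
  assumes r: "r \<ge> 1"
    and x: "x \<in> topspace (power_space r X)" "q \<in> topspace P"
    and x': "x' \<in> topspace (power_space r X)" "q' \<in> topspace P"
    and eq: "tuple_class r (x, q) = tuple_class r (x', q')"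
  obtains g where "g \<in> carrier G" "x' = power_action r \<phi> g x" "q' = \<psi> g q"
proof -
  have "\<exists>g \<in> carrier G. x' i = \<phi> g (x i) \<and> q' = \<psi> g q" if i: "i \<in> {1..r}" for i
  proof -
    have "\<kappa> (x i, q) = \<kappa> (x' i, q')"
      using fun_cong[OF eq, of i] i by (simp add: tuple_class_def)
    then show ?thesis
      using x x' i by (subst (asm) class_eq_iff) (auto simp: PiE_iff)
  qed
  then obtain g where g: "\<And>i. i \<in> {1..r} \<Longrightarrow> g i \<in> carrier G \<and> x' i = \<phi> (g i) (x i) \<and> q' = \<psi> (g i) q"
    by metis
  have const: "g i = g 1" if "i \<in> {1..r}" for i
    using action_free[OF _ _ x(2)] g[OF that] g[of 1] r by auto
  have "x' i = power_action r \<phi> (g 1) x i" for i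
  proof (cases "i \<in> {1..r}")
    case True
    then show ?thesis
      using g[OF True] const[OF True] by (simp add: power_action_def)
  next
    case False
    \<comment> \<open>Outside the index range both tuples take the value
      \<open>undefined\<close>.\<close>
    then show ?thesis
      using x'(1) by (auto simp: power_action_def PiE_iff extensional_def)
  qed
  then have "x' = power_action r \<phi> (g 1) x"
    by (rule ext)
  then show thesis
    using that[of "g 1"] g[of 1] r by simp
qed

lemma continuous_map_tuple_class:
  "continuous_map (prod_topology (power_space r X) P) (fibrewise_power r E p) (tuple_class r)"
proof -
  have "continuous_map (prod_topology (power_space r X) P) (prod_topology X P) (\<lambda>z. (fst z i, snd z))"
    if "i \<in> {1..r}" for i
    using continuous_map_compose[OF continuous_map_fst continuous_map_product_projection[OF that]]
    by (intro continuous_map_pairedI continuous_map_snd) (auto simp: o_def)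
  from continuous_map_compose[OF this quotient_imp_continuous_map[OF quotient]]
  have "continuous_map (prod_topology (power_space r X) P) (power_space r E) (tuple_class r)"
    unfolding continuous_map_componentwise
    by (auto simp: tuple_class_def o_def case_prod_unfold cong: restrict_cong)
  then show ?thesis
    unfolding fibrewise_power_def
    by (intro continuous_map_into_subtopology) (auto simp: tuple_class_def proj_class PiE_iff)
qed

text \<open>Near a given tuple, all entries \<open>e i\<close> lie over the common base point
  \<open>p (e 1)\<close> in one set \<open>V\<close>, so they have representatives with the same
  second entry \<open>\<sigma> (p (e 1))\<close>. Taking fibre coordinates entrywise is therefore a
  local section.\<close>

lemma quotient_map_tuple_class:
  assumes r: "r \<ge> 1"
  shows "quotient_map (prod_topology (power_space r X) P) (fibrewise_power r E p) (tuple_class r)"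
proof (rule quotient_map_if_local_sections[OF continuous_map_tuple_class])
  fix e assume e: "e \<in> topspace (fibrewise_power r E p)"
  let ?F = "fibrewise_power r E p"
  have coord: "continuous_map ?F E (\<lambda>e. e i)" if "i \<in> {1..r}" for i
    unfolding fibrewise_power_def
    by (intro continuous_map_from_subtopology continuous_map_product_projection that)
  have base: "continuous_map ?F B (\<lambda>e. p (e 1))"
    using continuous_map_compose[OF coord proj] r by (simp add: o_def)
  have base_in: "p (e 1) \<in> topspace B" if "e \<in> topspace ?F" for e
    using base that by (auto simp: continuous_map_def)
  have fibrewise: "e i \<in> topspace E" "p (e i) = p (e 1)" if "e \<in> topspace ?F" "i \<in> {1..r}" for e i
  proof -
    show "e i \<in> topspace E"
      using coord[OF that(2)] that(1) by (auto simp: continuous_map_def)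
    have "1 \<in> {1..r}"
      using r by simp
    then show "p (e i) = p (e 1)"
      using that unfolding fibrewise_power_def topspace_subtopology by blast
  qed
  obtain V \<sigma> \<xi> where V: "openin B V" "p (e 1) \<in> V" and \<sigma>: "continuous_map (subtopology B V) P \<sigma>"
    and \<xi>: "continuous_map (subtopology E {e \<in> topspace E. p e \<in> V}) X \<xi>"
    and \<kappa>: "\<And>e. \<lbrakk>e \<in> topspace E; p e \<in> V\<rbrakk> \<Longrightarrow> \<kappa> (\<xi> e, \<sigma> (p e)) = e"
    by (rule local_fibre_coordinate[OF base_in[OF e]]) (rule that, (assumption | simp)+)
  let ?W = "{e \<in> topspace ?F. p (e 1) \<in> V}"
  let ?s = "\<lambda>e. (\<lambda>i \<in> {1..r}. \<xi> (e i), \<sigma> (p (e 1)))"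
  have "openin ?F ?W"
    using base V(1) by (rule openin_continuous_map_preimage)
  moreover have "continuous_map (subtopology ?F ?W) (prod_topology (power_space r X) P) ?s"
  proof (rule continuous_map_pairedI)
    have "continuous_map (subtopology ?F ?W) X (\<lambda>e. \<xi> (e i))" if i: "i \<in> {1..r}" for i
    proof -
      have "continuous_map (subtopology ?F ?W) (subtopology E {e \<in> topspace E. p e \<in> V}) (\<lambda>e. e i)"
        unfolding continuous_map_in_subtopology
      proof (intro conjI funcsetI)
        show "continuous_map (subtopology ?F ?W) E (\<lambda>e. e i)"
          using coord[OF i] by (rule continuous_map_from_subtopology)
        fix d assume d: "d \<in> topspace (subtopology ?F ?W)"
        then have "d \<in> topspace ?F" "p (d 1) \<in> V"
          by auto
        then show "d i \<in> {e \<in> topspace E. p e \<in> V}"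
          using fibrewise[of d, OF _ i] by simp
      qed
      from continuous_map_compose[OF this \<xi>] show ?thesis
        by (simp add: o_def)
    qed
    then show "continuous_map (subtopology ?F ?W) (power_space r X) (\<lambda>e. \<lambda>i \<in> {1..r}. \<xi> (e i))"
      by (auto simp: continuous_map_componentwise)
    have "continuous_map (subtopology ?F ?W) (subtopology B V) (\<lambda>e. p (e 1))"
      using base by (auto simp: continuous_map_in_subtopology intro: continuous_map_from_subtopology)
    from continuous_map_compose[OF this \<sigma>]
    show "continuous_map (subtopology ?F ?W) P (\<lambda>e. \<sigma> (p (e 1)))"
      by (simp add: o_def)
  qed
  moreover have "tuple_class r (?s d) = d" if d: "d \<in> ?W" for d
  proof
    fix i
    show "tuple_class r (?s d) i = d i"
    proof (cases "i \<in> {1..r}")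
      case True
      then show ?thesis
        using \<kappa>[of "d i"] d fibrewise[of d, OF _ True] by (simp add: tuple_class_def)
    next
      case False
      moreover have "d \<in> topspace (power_space r E)"
        using d unfolding fibrewise_power_def topspace_subtopology by blast
      ultimately show ?thesis
        by (auto simp: tuple_class_def PiE_iff extensional_def)
    qed
  qed
  ultimately show "\<exists>V s. openin ?F V \<and> e \<in> V \<and>
      continuous_map (subtopology ?F V) (prod_topology (power_space r X) P) s \<and>
      (\<forall>v \<in> V. tuple_class r (s v) = v)"
    using e V(2) by (intro exI[of _ ?W] exI[of _ ?s] conjI ballI) auto
qed

text \<open>Fibres of \<open>tuple_class r\<close> lie in diagonal orbits, so invariance of
  \<open>U\<close> makes \<open>U \<times> P\<close> saturated; a quotient map sends saturated open
  sets to open sets.\<close>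

lemma openin_tuple_class_image:
  assumes r: "r \<ge> 1" and U: "openin (power_space r X) U"
    and inv: "\<And>g x. \<lbrakk>g \<in> carrier G; x \<in> U\<rbrakk> \<Longrightarrow> power_action r \<phi> g x \<in> U"
  shows "openin (fibrewise_power r E p) (tuple_class r ` (U \<times> topspace P))"
    and "{z \<in> topspace (prod_topology (power_space r X) P). tuple_class r z \<in> tuple_class r ` (U \<times> topspace P)}
      = U \<times> topspace P"
proof -
  let ?XP = "prod_topology (power_space r X) P"
  have sub: "U \<subseteq> topspace (power_space r X)"
    using U by (rule openin_subset)
  show eq: "{z \<in> topspace ?XP. tuple_class r z \<in> tuple_class r ` (U \<times> topspace P)} = U \<times> topspace P"
  proof
    show "{z \<in> topspace ?XP. tuple_class r z \<in> tuple_class r ` (U \<times> topspace P)} \<subseteq> U \<times> topspace P"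
    proof clarify
      fix x q y q'
      assume xq: "(x, q) \<in> topspace ?XP" and y: "y \<in> U" "q' \<in> topspace P"
        and eq: "tuple_class r (x, q) = tuple_class r (y, q')"
      have y_in: "y \<in> topspace (power_space r X)"
        using sub y(1) by (rule subsetD)
      have x_in: "x \<in> topspace (power_space r X)" "q \<in> topspace P"
        using xq by simp_all
      obtain g where "g \<in> carrier G" "x = power_action r \<phi> g y" "q = \<psi> g q'"
        by (rule tuple_class_eqD[OF r y_in y(2) x_in eq[symmetric]])
      then show "x \<in> U \<and> q \<in> topspace P"
        using x_in y inv by simp
    qed
  qed (use sub in auto)
  have "openin ?XP (U \<times> topspace P)"
    using U by (simp add: openin_prod_Times_iff)
  then show "openin (fibrewise_power r E p) (tuple_class r ` (U \<times> topspace P))"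
    using quotient_map_tuple_class[OF r] eq unfolding quotient_map_saturated_open by blast
qed

section \<open>From equivariant sections to fibrewise sections\<close>

text \<open>The section sends the class of \<open>(x, q)\<close> to the path
  \<open>u \<mapsto> [s x (\<sigma> u), q]\<close>. Here \<open>\<sigma>\<close> is a self-map of
  the interval carrying the times \<open>t\<close> to the times \<open>t'\<close>, not a section of
  the principal bundle.\<close>

lemma fibrewise_section_exists:
  assumes r: "r \<ge> 1" and U: "openin (power_space r X) U"
    and inv: "\<And>g x. \<lbrakk>g \<in> carrier G; x \<in> U\<rbrakk> \<Longrightarrow> power_action r \<phi> g x \<in> U"
    and s: "continuous_map (subtopology (power_space r X) U) (path_space X) s"
    and section_s: "\<And>x. x \<in> U \<Longrightarrow> eval_at r t' (s x) = x"
    and equivariant: "\<And>g x. \<lbrakk>g \<in> carrier G; x \<in> U\<rbrakk> \<Longrightarrow> s (power_action r \<phi> g x) = path_action \<phi> g (s x)"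
    and \<sigma>: "continuous_map (top_of_set {0..1}) (top_of_set {0..1}) \<sigma>"
    and t: "\<And>i. i \<in> {1..r} \<Longrightarrow> t i \<in> {0..1} \<and> \<sigma> (t i) = t' i"
  defines "W \<equiv> tuple_class r ` (U \<times> topspace P)"
  shows "\<exists>S. continuous_map (subtopology (fibrewise_power r E p) W) (fibrewise_path_space E p) S \<and>
    (\<forall>e \<in> W. eval_at r t (S e) = e)"
proof -
  let ?I = "top_of_set {0..1::real}"
  let ?UP = "subtopology (prod_topology (power_space r X) P) (U \<times> topspace P)"
  have sub: "U \<subseteq> topspace (power_space r X)"
    using U by (rule openin_subset)
  have UP: "topspace ?UP = U \<times> topspace P"
    using sub by auto
  have path: "continuous_map ?I X (s x)" if "x \<in> U" for x
  proof -
    have "x \<in> topspace (subtopology (power_space r X) U)"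
      using sub that unfolding topspace_subtopology by blast
    then have "s x \<in> topspace (path_space X)"
      using continuous_map_funspace[OF s] by (rule funcset_mem[rotated])
    then show ?thesis
      by (simp add: topspace_compact_open_topology)
  qed
  have \<sigma>_in: "\<sigma> u \<in> {0..1}" if "u \<in> {0..1}" for u
    using \<sigma> that by (auto simp: continuous_map_def)
  have path_in: "s x u \<in> topspace X" if "x \<in> U" "u \<in> {0..1}" for x u
    using path[OF that(1)] that(2) by (auto simp: continuous_map_def)
  \<comment> \<open>\<open>H\<close> is the two-variable form of the path family and
    \<open>c\<close> its curried form: \<open>H\<close> is shown continuous by evaluation,
    \<open>c\<close> by currying.\<close>
  define H where "H = (\<lambda>z. \<kappa> (s (fst (fst z)) (\<sigma> (snd z)), snd (fst z)))"
  define c where "c = (\<lambda>z. \<lambda>u \<in> {0..1::real}. H (z, u))"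
  have "continuous_map (prod_topology ?UP ?I) E H"
  proof -
    have "continuous_map ?UP (subtopology (power_space r X) U) fst"
      by (auto simp: continuous_map_in_subtopology intro: continuous_map_from_subtopology continuous_map_fst)
    from continuous_map_compose[OF continuous_map_compose[OF continuous_map_fst this] s]
    have 1: "continuous_map (prod_topology ?UP ?I) (path_space X) (\<lambda>z. s (fst (fst z)))"
      by (simp add: o_def)
    have 2: "continuous_map (prod_topology ?UP ?I) ?I (\<lambda>z. \<sigma> (snd z))"
      using continuous_map_compose[OF continuous_map_snd \<sigma>] by (simp add: o_def)
    have "continuous_map ?UP P snd"
      by (intro continuous_map_from_subtopology continuous_map_snd)
    from continuous_map_compose[OF continuous_map_fst this]
    have 3: "continuous_map (prod_topology ?UP ?I) P (\<lambda>z. snd (fst z))"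
      by (simp add: o_def)
    from continuous_map_compose[OF continuous_map_pairedI[OF 1 2]
        continuous_map_eval_compact_open[OF neighbourhood_base_of_compactin_unit_interval]]
    have "continuous_map (prod_topology ?UP ?I) X (\<lambda>z. s (fst (fst z)) (\<sigma> (snd z)))"
      by (simp add: o_def)
    from continuous_map_compose[OF continuous_map_pairedI[OF this 3] quotient_imp_continuous_map[OF quotient]]
    show ?thesis
      by (simp add: o_def H_def)
  qed
  from continuous_map_curry_compact_open[OF this]
  have "continuous_map ?UP (path_space E) c"
    by (simp add: c_def)
  \<comment> \<open>Only the \<open>X\<close> entry varies along the path, so it stays in the fibre
    over \<open>\<tau> q\<close>.\<close>
  moreover have "\<exists>b. \<forall>u \<in> {0..1}. p (c z u) = b" if "z \<in> topspace ?UP" for z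
    using that path_in \<sigma>_in unfolding UP c_def H_def
    by (intro exI[of _ "\<tau> (snd z)"]) (auto simp: proj_class)
  ultimately have c: "continuous_map ?UP (fibrewise_path_space E p) c"
    unfolding fibrewise_path_space_def by (auto simp: continuous_map_in_subtopology)
  have c_eq: "\<forall>z \<in> topspace ?UP. \<forall>z' \<in> topspace ?UP. tuple_class r z = tuple_class r z' \<longrightarrow> c z = c z'"
  proof (intro ballI impI)
    fix z z' assume z: "z \<in> topspace ?UP" "z' \<in> topspace ?UP" and eq: "tuple_class r z = tuple_class r z'"
    obtain x q x' q' where xq: "z = (x, q)" "z' = (x', q')"
      by (metis surj_pair)
    with z have in_U: "x \<in> U" "q \<in> topspace P" "x' \<in> U" "q' \<in> topspace P"
      unfolding UP by auto
    have "x \<in> topspace (power_space r X)" "x' \<in> topspace (power_space r X)"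
      using sub in_U by (auto simp del: topspace_product_topology)
    from tuple_class_eqD[OF r this(1) in_U(2) this(2) in_U(4) eq[unfolded xq]]
    obtain g where g: "g \<in> carrier G" "x' = power_action r \<phi> g x" "q' = \<psi> g q"
      by blast
    \<comment> \<open>Equivariance moves \<open>g\<close> out of \<open>s\<close>, and
      \<open>g\<close> then acts on both entries of the pair, leaving the class unchanged.\<close>
    have "H (z, u) = H (z', u)" if u: "u \<in> {0..1}" for u
      using g in_U path_in[of x "\<sigma> u"] \<sigma>_in[OF u] equivariant[of g x]
      by (simp add: H_def xq path_action_def class_action)
    then show "c z = c z'"
      by (auto simp: c_def)
  qed
  have "quotient_map ?UP (subtopology (fibrewise_power r E p) W) (tuple_class r)"
    using openin_tuple_class_image[OF r U inv] unfolding W_def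
    by (intro quotient_map_restriction[OF quotient_map_tuple_class[OF r]]) auto
  from quotient_map_factor_exists[OF this c c_eq]
  obtain S where S: "continuous_map (subtopology (fibrewise_power r E p) W) (fibrewise_path_space E p) S"
    and Sc: "\<forall>z \<in> topspace ?UP. S (tuple_class r z) = c z"
    by (elim exE conjE) (rule that)
  show ?thesis
  proof (intro exI[of _ S] conjI ballI S)
    fix e assume "e \<in> W"
    then obtain x q where xq: "x \<in> U" "q \<in> topspace P" "e = tuple_class r (x, q)"
      unfolding W_def by auto
    then have S_e: "S e = c (x, q)"
      using Sc UP by auto
    \<comment> \<open>At time \<open>t i\<close> the new path is \<open>[s x (t' i), q]\<close>,
      since \<open>\<sigma> (t i) = t' i\<close>.\<close>
    have "s x (t' i) = x i" if "i \<in> {1..r}" for i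
      using fun_cong[OF section_s[OF xq(1)], of i] that by (simp add: eval_at_def)
    then show "eval_at r t (S e) = e"
      unfolding S_e using t xq(3) by (auto simp: eval_at_def tuple_class_def c_def H_def)
  qed
qed

text \<open>Each cover counted on the right yields a cover of the same length counted on the left,
  so the left infimum runs over a larger set. If no equivariant cover exists, the right side is
  infinite.\<close>

theorem parametrized_TC_le_equivariant_TC:
  assumes r: "r \<ge> 1" and times: "inj_on t {1..r}" "t ` {1..r} \<subseteq> {0..1}" "t' ` {1..r} \<subseteq> {0..1}"
  shows "parametrized_TC r t E p \<le> equivariant_TC r t' G X \<phi>"
  unfolding parametrized_TC_def secat_def equivariant_TC_def
proof (rule Inf_superset_mono, clarify)
  fix k and U :: "nat \<Rightarrow> (nat \<Rightarrow> 'x) set"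
  assume U: "\<forall>i\<le>k. openin (power_space r X) (U i)"
    and cover: "(\<Union>i\<le>k. U i) = topspace (power_space r X)"
    and inv: "\<forall>i\<le>k. \<forall>g \<in> carrier G. \<forall>x \<in> U i. power_action r \<phi> g x \<in> U i"
    and sections: "\<forall>i\<le>k. \<exists>s. continuous_map (subtopology (power_space r X) (U i)) (path_space X) s \<and>
        (\<forall>x \<in> U i. eval_at r t' (s x) = x) \<and>
        (\<forall>g \<in> carrier G. \<forall>x \<in> U i. s (power_action r \<phi> g x) = path_action \<phi> g (s x))"
  obtain \<sigma> where \<sigma>: "continuous_map (top_of_set {0..1}) (top_of_set {0..1::real}) \<sigma>"
      "\<And>i. i \<in> {1..r} \<Longrightarrow> \<sigma> (t i) = t' i"
    using reparametrization_exists[of "{1..r}" t t'] times by auto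
  let ?W = "\<lambda>i. tuple_class r ` (U i \<times> topspace P)"
  have "openin (fibrewise_power r E p) (?W i)" if "i \<le> k" for i
    using U inv that by (intro openin_tuple_class_image(1)[OF r]) blast+
  moreover have "(\<Union>i\<le>k. ?W i) = topspace (fibrewise_power r E p)"
  proof -
    \<comment> \<open>Images commute with unions, so covering follows from surjectivity of
      \<open>tuple_class r\<close>.\<close>
    have "(\<Union>i\<le>k. ?W i) = tuple_class r ` ((\<Union>i\<le>k. U i) \<times> topspace P)"
      by blast
    then show ?thesis
      using quotient_imp_surjective_map[OF quotient_map_tuple_class[OF r]] cover by simp
  qed
  moreover have "\<exists>S. continuous_map (subtopology (fibrewise_power r E p) (?W i)) (fibrewise_path_space E p) S \<and>
      (\<forall>e \<in> ?W i. eval_at r t (S e) = e)" if i: "i \<le> k" for i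
  proof -
    from sections i obtain s where
      s: "continuous_map (subtopology (power_space r X) (U i)) (path_space X) s"
        "\<forall>x \<in> U i. eval_at r t' (s x) = x"
        "\<forall>g \<in> carrier G. \<forall>x \<in> U i. s (power_action r \<phi> g x) = path_action \<phi> g (s x)"
      by blast
    show ?thesis
    proof (rule fibrewise_section_exists[OF r _ _ s(1) _ _ \<sigma>(1)])
      show "openin (power_space r X) (U i)"
        using U i by blast
      show "power_action r \<phi> g x \<in> U i" if "g \<in> carrier G" "x \<in> U i" for g x
        using inv i that by blast
      show "eval_at r t' (s x) = x" if "x \<in> U i" for x
        using s(2) that by blast
      show "s (power_action r \<phi> g x) = path_action \<phi> g (s x)" if "g \<in> carrier G" "x \<in> U i" for g x
        using s(3) that by blast
      show "t j \<in> {0..1} \<and> \<sigma> (t j) = t' j" if "j \<in> {1..r}" for j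
        using \<sigma>(2)[OF that] times(2) that by blast
    qed
  qed
  ultimately show "\<exists>k'. enat k = enat k' \<and> (\<exists>W.
      (\<forall>i\<le>k'. openin (fibrewise_power r E p) (W i)) \<and> (\<Union>i\<le>k'. W i) = topspace (fibrewise_power r E p) \<and>
      (\<forall>i\<le>k'. \<exists>s. continuous_map (subtopology (fibrewise_power r E p) (W i)) (fibrewise_path_space E p) s \<and>
        (\<forall>e \<in> W i. eval_at r t (s e) = e)))"
    by (intro exI[of _ k] exI[of _ ?W] conjI allI impI refl)
qed

end

section \<open>Diagonal orbits and the passage to the orbit space\<close>

lemma orbit_diagonal_eq_iff:
  assumes "group_action G (topspace X) \<phi>" "group_action G (topspace P) \<psi>"
    and "x \<in> topspace X" "q \<in> topspace P" "x' \<in> topspace X" "q' \<in> topspace P"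
  shows "orbit G (diagonal_action X P \<phi> \<psi>) (x, q) = orbit G (diagonal_action X P \<phi> \<psi>) (x', q') \<longleftrightarrow>
    (\<exists>g \<in> carrier G. x' = \<phi> g x \<and> q' = \<psi> g q)"
proof -
  interpret X: group_action G "topspace X" \<phi> by fact
  interpret P: group_action G "topspace P" \<psi> by fact
  interpret group G
    using X.group_hom by (simp add: group_hom_def)
  have orbit: "orbit G (diagonal_action X P \<phi> \<psi>) (y, w) = {(\<phi> g y, \<psi> g w) | g. g \<in> carrier G}"
    if "y \<in> topspace X" "w \<in> topspace P" for y w
    using that by (simp add: orbit_def diagonal_action_def)
  show ?thesis
  proof
    assume eq: "orbit G (diagonal_action X P \<phi> \<psi>) (x, q) = orbit G (diagonal_action X P \<phi> \<psi>) (x', q')"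
    have "\<phi> \<one>\<^bsub>G\<^esub> x' = x'" "\<psi> \<one>\<^bsub>G\<^esub> q' = q'"
      using assms X.id_eq_one P.id_eq_one by (metis restrict_apply')+
    then have "(x', q') \<in> orbit G (diagonal_action X P \<phi> \<psi>) (x', q')"
      using assms orbit by (auto intro!: exI[of _ "\<one>\<^bsub>G\<^esub>"])
    then show "\<exists>g \<in> carrier G. x' = \<phi> g x \<and> q' = \<psi> g q"
      unfolding eq[symmetric] orbit[OF assms(3,4)] by blast
  next
    assume "\<exists>g \<in> carrier G. x' = \<phi> g x \<and> q' = \<psi> g q"
    then obtain g where g: "g \<in> carrier G" "x' = \<phi> g x" "q' = \<psi> g q"
      by blast
    \<comment> \<open>The two orbits are matched by right multiplication of the group parameter by
      \<open>g\<close> and by its inverse.\<close>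
    have "(\<phi> k x', \<psi> k q') = (\<phi> (k \<otimes>\<^bsub>G\<^esub> g) x, \<psi> (k \<otimes>\<^bsub>G\<^esub> g) q)" if "k \<in> carrier G" for k
      using that g assms by (simp add: X.composition_rule P.composition_rule)
    moreover have "(\<phi> k x, \<psi> k q) = (\<phi> (k \<otimes>\<^bsub>G\<^esub> inv\<^bsub>G\<^esub> g) x', \<psi> (k \<otimes>\<^bsub>G\<^esub> inv\<^bsub>G\<^esub> g) q')"
      if "k \<in> carrier G" for k
      using that g assms by (simp add: X.composition_rule P.composition_rule X.orbit_sym_aux P.orbit_sym_aux)
    moreover have "k \<otimes>\<^bsub>G\<^esub> g \<in> carrier G" "k \<otimes>\<^bsub>G\<^esub> inv\<^bsub>G\<^esub> g \<in> carrier G" if "k \<in> carrier G" for k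
      using that g(1) by simp_all
    ultimately show "orbit G (diagonal_action X P \<phi> \<psi>) (x, q) = orbit G (diagonal_action X P \<phi> \<psi>) (x', q')"
      unfolding orbit[OF assms(3,4)] orbit[OF assms(5,6)] by blast
  qed
qed

theorem theorem3p4:
  fixes G :: "('g, 'm) monoid_scheme" and T :: "'g topology"
    and X :: "'x topology" and \<phi> :: "'g \<Rightarrow> 'x \<Rightarrow> 'x"
    and P :: "'p topology" and \<psi> :: "'g \<Rightarrow> 'p \<Rightarrow> 'p"
    and E :: "'e topology" and B :: "'b topology"
    and p :: "'e \<Rightarrow> 'b" and \<tau> :: "'p \<Rightarrow> 'b"
    and r :: nat and t t' :: "nat \<Rightarrow> real"
  assumes locally_trivial: "bundle_with_structure_group G T X \<phi> E B p"
    and fibre: "path_connected_space X"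
    and principal: "principal_bundle G T P \<psi> B \<tau>"
    and associated: "is_associated_bundle G X \<phi> P \<psi> \<tau> E p"
    and r: "r \<ge> 2"
    and times: "strict_mono_on {1..r} t" "t ` {1..r} \<subseteq> {0..1}"
    and times': "strict_mono_on {1..r} t'" "t' 1 = 0" "t' r = 1"
  shows "parametrized_TC r t E p \<le> equivariant_TC r t' G X \<phi>"
proof -
  let ?o = "orbit G (diagonal_action X P \<phi> \<psi>)"
  obtain h where h: "homeomorphic_map (associated_space G X \<phi> P \<psi>) E h"
    and ph: "\<And>x q. \<lbrakk>x \<in> topspace X; q \<in> topspace P\<rbrakk> \<Longrightarrow> p (h (?o (x, q))) = \<tau> q"
    using associated unfolding is_associated_bundle_def by blast
  have actions: "group_action G (topspace X) \<phi>" "group_action G (topspace P) \<psi>"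
    using locally_trivial principal
    by (auto simp: bundle_with_structure_group_def principal_bundle_def continuous_action_def)
  \<comment> \<open>Injectivity of \<open>h\<close> reduces equality in \<open>E\<close> to equality
    of orbits, as needed for \<open>class_eq_iff\<close> with
    \<open>\<kappa> = h \<circ> ?o\<close>.\<close>
  have inj: "h (?o (x, q)) = h (?o (x', q')) \<longleftrightarrow> ?o (x, q) = ?o (x', q')"
    if "x \<in> topspace X" "q \<in> topspace P" "x' \<in> topspace X" "q' \<in> topspace P" for x q x' q'
    using homeomorphic_imp_injective_map[OF h] that by (intro inj_on_eq_iff) (auto simp: orbits_def)
  interpret associated_bundle G T X \<phi> P \<psi> E B p \<tau> "h \<circ> ?o"
  proof
    show "quotient_map (prod_topology X P) E (h \<circ> ?o)"
      using quotient_map_orbit_space h[unfolded homeomorphic_map_def, THEN conjunct1]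
      by (rule quotient_map_compose)
  qed (use locally_trivial principal ph inj orbit_diagonal_eq_iff[OF actions] in
      \<open>simp_all add: bundle_with_structure_group_def\<close>)
  \<comment> \<open>Monotonicity confines the times between the endpoint values
    \<open>t' 1 = 0\<close> and \<open>t' r = 1\<close>.\<close>
  have "t' i \<in> {0..1}" if "i \<in> {1..r}" for i
    using strict_mono_on_leD[OF times'(1), of 1 i] strict_mono_on_leD[OF times'(1), of i r] that times'
    by auto
  then show ?thesis
    using r times strict_mono_on_imp_inj_on by (intro parametrized_TC_le_equivariant_TC) auto
qed

end
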